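(* Let $0<k\in\mathbb N$ and $0<\ell\in\mathbb Q$ with $\ell\neq\frac{2k}{m}-1$ for all nonzero $m\in\mathbb Z$. Put $n=\ell+1$, $\alpha=\frac{2k\pi}{n}$ and $p(\varphi)=a+\cos(\ell\varphi)$, where $a>\ell^2-1$ if $\ell>1$, and $a>1-\ell^2$ if $0<\ell<1$. Consider the Poncelet pair $(K,C)$ given by $$C:\ \varphi\mapsto X(\varphi)=p(\varphi)u(\varphi)+p'(\varphi)u'(\varphi),$$ $$K:\ \varphi\mapsto Y(\varphi)=\frac{1}{\sin\alpha}\bigl(p(\varphi+\alpha)u'(\varphi)-p(\varphi)u'(\varphi+\alpha)\bigr).$$ Then the Poncelet polygon $P$ for $(K,C)$ is equiangular with angle $\alpha$ and equilateral with side length $2a\,|\tan(\alpha/2)|$. The curve $K$ is an epitrochoid. The midpoint (center) of $P$ rotates on the circle centered at the origin with radius $1$ (as the starting point of $P$ varies).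
   Context: Notation: $u(\varphi)=(\cos\varphi,\sin\varphi)$, $u'(\varphi)=(-\sin\varphi,\cos\varphi)$. The parameter $\varphi$ ranges over $\mathbb R$; since $\ell$ is rational, both curves are closed (periodic in $\varphi$). Poncelet pair: closed plane curves $K$ (vertex curve) and $C$ (envelope) such that every point of $K$ is a vertex of a polygon $P$ (Poncelet polygon) inscribed in $K$ and circumscribed about $C$, where circumscribed means that the lines containing the sides of $P$ are tangent to $C$ (the contact point may lie on the prolongation of the side). The Poncelet polygon $P$ with starting point $Y(\varphi)$ has the vertices $Y(\varphi+j\alpha)$, $j=0,1,2,\ldots$, in this order, until it closes; $Y(\varphi)$ is the intersection of the tangent lines of $C$ at $X(\varphi)$ and $X(\varphi+\alpha)$. Equiangular with angle $\alpha$ means that all external (turning) angles of $P$ equal $\alpha$ (modulo $2\pi$), independently of the starting point. An epitrochoid is a curve which, up to reparametrization and Euclidean motion, has the form $\varphi\mapsto A\,u(\varphi)+B\,u(\nu\varphi)$ with real constants $A,B\ne0$ and $\nu>1$. *)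

theory Defs
  imports "HOL-Analysis.Analysis"
begin

text \<open>
  The Euclidean plane is the type \<^typ>\<open>complex\<close>, a point (x, y) being \<open>Complex x y\<close>.
  A curve is a map from the reals to the plane.
\<close>

definition uvec :: "real \<Rightarrow> complex" where
  "uvec \<phi> = Complex (cos \<phi>) (sin \<phi>)"

definition uvec' :: "real \<Rightarrow> complex" where
  "uvec' \<phi> = Complex (- sin \<phi>) (cos \<phi>)"

text \<open>The envelope of the lines with equation \<open>x \<bullet> uvec \<phi> = p \<phi>\<close>.\<close>

definition envelope_curve :: "(real \<Rightarrow> real) \<Rightarrow> real \<Rightarrow> complex" where
  "envelope_curve p \<phi> = p \<phi> *\<^sub>R uvec \<phi> + deriv p \<phi> *\<^sub>R uvec' \<phi>"

definition vertex_curve :: "(real \<Rightarrow> real) \<Rightarrow> real \<Rightarrow> real \<Rightarrow> complex" where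
  "vertex_curve p \<alpha> \<phi> =
     (1 / sin \<alpha>) *\<^sub>R (p (\<phi> + \<alpha>) *\<^sub>R uvec' \<phi> - p \<phi> *\<^sub>R uvec' (\<phi> + \<alpha>))"

definition closed_curve :: "(real \<Rightarrow> complex) \<Rightarrow> bool" where
  "closed_curve c \<longleftrightarrow> continuous_on UNIV c \<and> (\<exists>T>0. \<forall>t. c (t + T) = c t)"

definition tangent_line :: "(real \<Rightarrow> complex) \<Rightarrow> real \<Rightarrow> complex set" where
  "tangent_line c t = {c t + s *\<^sub>R vector_derivative c (at t) | s. True}"

text \<open>Tangency is only considered at regular points of the curve.\<close>

definition tangent_to :: "complex set \<Rightarrow> (real \<Rightarrow> complex) \<Rightarrow> bool" where
  "tangent_to L c \<longleftrightarrow>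
     (\<exists>t. c differentiable at t \<and> vector_derivative c (at t) \<noteq> 0 \<and> L = tangent_line c t)"

text \<open>
  A polygon is the list of its vertices in cyclic order. It may intersect itself, but
  consecutive sides must not lie on a common line; in particular consecutive vertices are
  distinct, so that the line containing a side and the external angles are well defined.
\<close>

definition vertex :: "complex list \<Rightarrow> nat \<Rightarrow> complex" where
  "vertex P j = P ! (j mod length P)"

definition side :: "complex list \<Rightarrow> nat \<Rightarrow> complex" where
  "side P j = vertex P (Suc j) - vertex P j"

definition polygon :: "complex list \<Rightarrow> bool" where
  "polygon P \<longleftrightarrow> 3 \<le> length P \<and>
     (\<forall>j < length P. \<not> collinear {vertex P j, vertex P (j + 1), vertex P (j + 2)})"

definition inscribed :: "complex list \<Rightarrow> (real \<Rightarrow> complex) \<Rightarrow> bool" where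
  "inscribed P K \<longleftrightarrow> set P \<subseteq> range K"

definition circumscribed :: "complex list \<Rightarrow> (real \<Rightarrow> complex) \<Rightarrow> bool" where
  "circumscribed P C \<longleftrightarrow>
     (\<forall>j < length P. tangent_to (affine hull {vertex P j, vertex P (j + 1)}) C)"

definition poncelet_polygon :: "complex list \<Rightarrow> (real \<Rightarrow> complex) \<Rightarrow> (real \<Rightarrow> complex) \<Rightarrow> bool" where
  "poncelet_polygon P K C \<longleftrightarrow> polygon P \<and> inscribed P K \<and> circumscribed P C"

definition poncelet_pair :: "(real \<Rightarrow> complex) \<Rightarrow> (real \<Rightarrow> complex) \<Rightarrow> bool" where
  "poncelet_pair K C \<longleftrightarrow> closed_curve K \<and> closed_curve C \<and>
     (\<forall>x \<in> range K. \<exists>P. x \<in> set P \<and> poncelet_polygon P K C)"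

text \<open>
  The polygon with vertices \<open>Y (\<phi> + j * \<alpha>)\<close>, j = 0, 1, 2, ..., until it closes, i.e. until
  the vertex sequence starts to repeat. The list is meaningful only if the sequence closes.
\<close>

definition closes_after :: "(real \<Rightarrow> complex) \<Rightarrow> real \<Rightarrow> real \<Rightarrow> nat \<Rightarrow> bool" where
  "closes_after Y \<alpha> \<phi> N \<longleftrightarrow>
     0 < N \<and> (\<forall>j. Y (\<phi> + real (j + N) * \<alpha>) = Y (\<phi> + real j * \<alpha>))"

definition polygon_from :: "(real \<Rightarrow> complex) \<Rightarrow> real \<Rightarrow> real \<Rightarrow> complex list" where
  "polygon_from Y \<alpha> \<phi> =
     map (\<lambda>j. Y (\<phi> + real j * \<alpha>)) [0..<(LEAST N. closes_after Y \<alpha> \<phi> N)]"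

text \<open>
  The signed angle from one side vector to the next is the argument of their quotient,
  normalised to lie between \<open>-pi\<close> (exclusive) and \<open>pi\<close>.
\<close>

definition external_angle :: "complex list \<Rightarrow> nat \<Rightarrow> real" where
  "external_angle P j = Arg (side P (j + 1) / side P j)"

definition equiangular :: "complex list \<Rightarrow> real \<Rightarrow> bool" where
  "equiangular P \<alpha> \<longleftrightarrow>
     (\<forall>j < length P. \<exists>m::int. external_angle P j = \<alpha> + 2 * pi * of_int m)"

definition equilateral :: "complex list \<Rightarrow> real \<Rightarrow> bool" where
  "equilateral P s \<longleftrightarrow> (\<forall>j < length P. norm (side P j) = s)"

text \<open>
  The centre of a regular (possibly star-shaped) polygon is the point equidistant from all
  its vertices.
\<close>

definition is_center :: "complex \<Rightarrow> complex list \<Rightarrow> bool" where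
  "is_center c P \<longleftrightarrow> (\<exists>r. \<forall>v \<in> set P. dist c v = r)"

definition reparametrization :: "(real \<Rightarrow> real) \<Rightarrow> bool" where
  "reparametrization \<sigma> \<longleftrightarrow>
     bij \<sigma> \<and> (\<forall>t. \<exists>d. d \<noteq> 0 \<and> (\<sigma> has_real_derivative d) (at t))"

definition euclidean_motion :: "(complex \<Rightarrow> complex) \<Rightarrow> bool" where
  "euclidean_motion M \<longleftrightarrow> (\<forall>x y. dist (M x) (M y) = dist x y)"

definition epitrochoid :: "(real \<Rightarrow> complex) \<Rightarrow> bool" where
  "epitrochoid c \<longleftrightarrow>
     (\<exists>A B \<nu> \<sigma> M. A \<noteq> 0 \<and> B \<noteq> 0 \<and> \<nu> > 1 \<and> reparametrization \<sigma> \<and> euclidean_motion M \<and>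
        (\<forall>\<phi>. c \<phi> = M (A *\<^sub>R uvec (\<sigma> \<phi>) + B *\<^sub>R uvec (\<nu> * \<sigma> \<phi>))))"

text \<open>
  A moving point rotates on a circle if its polar angle is continuous and strictly monotone
  (equivalently here, continuous and injective) and runs through all reals, so that the
  whole circle is traversed in one sense of rotation.
\<close>

definition rotates_on_circle :: "(real \<Rightarrow> complex) \<Rightarrow> complex \<Rightarrow> real \<Rightarrow> bool" where
  "rotates_on_circle m c r \<longleftrightarrow>
     (\<exists>\<theta>. continuous_on UNIV \<theta> \<and> bij \<theta> \<and> (\<forall>t. m t = c + r *\<^sub>R uvec (\<theta> t)))"

end

theory Submission
  imports Defs
begin

text \<open>
  In complex notation \<open>uvec t = cis t\<close>, and everything rests on one computation. Since
  \<open>(l + 1) * \<alpha> = 2 * k * pi\<close>, the shifted support function is \<open>p (\<phi> + \<alpha>) = a + cos (l * \<phi> - \<alpha>)\<close>,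
  and the vertex curve collapses to a sum of two uniform rotations,
  \<open>Y \<phi> = cis (n * \<phi>) + R * cis (\<phi> + \<alpha> / 2)\<close> with \<open>R = a / cos (\<alpha> / 2)\<close>
  (\<open>vertex_curve_eq\<close>).

  The step \<open>\<phi> \<mapsto> \<phi> + \<alpha>\<close> fixes the first summand, because \<open>n * \<alpha>\<close> is a multiple of \<open>2 * pi\<close>,
  and multiplies the second by \<open>cis \<alpha>\<close>. Hence the vertices \<open>Y (\<phi> + j * \<alpha>)\<close> form a regular,
  possibly star-shaped, polygon of circumradius \<open>\<bar>R\<bar>\<close> about the point \<open>cis (n * \<phi>)\<close> of the unit
  circle. It closes because \<open>\<alpha>\<close> is a rational multiple of \<open>2 * pi\<close>, and it is nondegenerate
  because the condition \<open>l \<noteq> 2 * k / m - 1\<close> says exactly that \<open>sin \<alpha> \<noteq> 0\<close>. Closing, angles,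
  side lengths and centre then follow for any such orbit of a rotation (the lemmas on regular
  polygons). The same formula for \<open>Y\<close> is an epitrochoid up to a rotation of the plane and a shift
  of the parameter.

  For the tangency, \<open>X' = (p + p'') *\<^sub>R uvec'\<close>, where
  \<open>p + p'' = a - (l\<^sup>2 - 1) * cos (l * \<phi>)\<close> never vanishes by the bound on \<open>a\<close>. So every
  point of \<open>X\<close> is regular, its tangent is the line \<open>z \<bullet> uvec \<phi> = p \<phi>\<close>, and \<open>Y \<phi>\<close> is the
  intersection of the lines at \<open>\<phi>\<close> and \<open>\<phi> + \<alpha>\<close>. Two consecutive vertices therefore share the
  tangent at the parameter of the second one, which makes the polygon circumscribed.
\<close>

section \<open>The moving frame in complex notation\<close>

lemma uvec_eq_cis: "uvec t = cis t"
  by (simp add: uvec_def cis.ctr)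

lemma uvec'_eq_cis: "uvec' t = \<i> * cis t"
  by (simp add: uvec'_def complex_eq_iff)

lemma uvec_has_vector_derivative:
  "(uvec has_vector_derivative uvec' t) (at t)"
proof -
  have "((\<lambda>t. cis t) has_vector_derivative uvec' t) (at t)"
    unfolding uvec'_eq_cis cis_conv_exp
    by (rule has_vector_derivative_real_field) (auto intro!: derivative_eq_intros)
  then show ?thesis
    by (simp add: uvec_eq_cis [abs_def])
qed

lemma uvec'_has_vector_derivative:
  "(uvec' has_vector_derivative - uvec t) (at t)"
proof -
  have "((\<lambda>t. \<i> * uvec t) has_vector_derivative \<i> * uvec' t) (at t)"
    by (rule has_vector_derivative_mult_right) (rule uvec_has_vector_derivative)
  then show ?thesis
    by (simp add: uvec_eq_cis uvec'_eq_cis [abs_def] flip: mult.assoc)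
qed

lemma frame_decomposition: "z = (z \<bullet> uvec t) *\<^sub>R uvec t + (z \<bullet> uvec' t) *\<^sub>R uvec' t"
proof -
  have "(z \<bullet> uvec t) *\<^sub>R uvec t + (z \<bullet> uvec' t) *\<^sub>R uvec' t = ((cos t)\<^sup>2 + (sin t)\<^sup>2) *\<^sub>R z"
    by (simp only: complex_eq_iff)
      (simp add: uvec_def uvec'_def inner_complex_def power2_eq_square algebra_simps
        del: sin_cos_squared_add sin_cos_squared_add2 sin_cos_squared_add3)
  then show ?thesis by simp
qed

lemma inner_uvec_uvec [simp]: "uvec t \<bullet> uvec s = cos (t - s)"
  and inner_uvec'_uvec [simp]: "uvec' t \<bullet> uvec s = sin (s - t)"
  by (simp_all add: uvec_def uvec'_def inner_complex_def cos_diff sin_diff)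

section \<open>Support functions\<close>

text \<open>
  The terms \<open>p' *\<^sub>R uvec\<close> cancel: the line with normal \<open>uvec t\<close> is tangent to its envelope. The
  remaining factor \<open>p + p''\<close> is the signed radius of curvature.
\<close>

lemma envelope_curve_has_vector_derivative:
  assumes p: "\<And>x. (p has_real_derivative p' x) (at x)"
    and p': "(p' has_real_derivative p'') (at t)"
  shows "(envelope_curve p has_vector_derivative (p t + p'') *\<^sub>R uvec' t) (at t)"
proof -
  have dp: "deriv p = p'"
    using p by (auto intro!: ext DERIV_imp_deriv)
  have "((\<lambda>t. p t *\<^sub>R uvec t + p' t *\<^sub>R uvec' t) has_vector_derivative
      (p t *\<^sub>R uvec' t + p' t *\<^sub>R uvec t) + (p' t *\<^sub>R (- uvec t) + p'' *\<^sub>R uvec' t)) (at t)"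
    by (intro has_vector_derivative_add has_vector_derivative_scaleR p p'
        uvec_has_vector_derivative uvec'_has_vector_derivative)
  moreover have "envelope_curve p = (\<lambda>t. p t *\<^sub>R uvec t + p' t *\<^sub>R uvec' t)"
    by (simp add: envelope_curve_def [abs_def] dp)
  ultimately show ?thesis
    by (simp add: algebra_simps)
qed

text \<open>
  Passes from the parametric form in which tangent lines and affine hulls arise to the
  equation of the line, in which incidence is easy to decide.
\<close>

lemma support_line_param:
  "{(r *\<^sub>R uvec t + q *\<^sub>R uvec' t) + s *\<^sub>R (d *\<^sub>R uvec' t) | s. True} = {z. z \<bullet> uvec t = r}"
  if "d \<noteq> 0"
proof (intro set_eqI iffI)
  fix z assume "z \<in> {(r *\<^sub>R uvec t + q *\<^sub>R uvec' t) + s *\<^sub>R (d *\<^sub>R uvec' t) | s. True}"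
  then obtain s where "z = (r *\<^sub>R uvec t + q *\<^sub>R uvec' t) + s *\<^sub>R (d *\<^sub>R uvec' t)"
    by blast
  then show "z \<in> {z. z \<bullet> uvec t = r}"
    by (simp add: inner_add_left)
next
  fix z assume "z \<in> {z. z \<bullet> uvec t = r}"
  then have r: "r = z \<bullet> uvec t" by simp
  define s where "s = (z \<bullet> uvec' t - q) / d"
  have sd: "s * d = z \<bullet> uvec' t - q"
    using that by (simp add: s_def)
  have "(r *\<^sub>R uvec t + q *\<^sub>R uvec' t) + s *\<^sub>R (d *\<^sub>R uvec' t)
      = r *\<^sub>R uvec t + (q + s * d) *\<^sub>R uvec' t"
    by (simp add: scaleR_add_left add.assoc)
  also have "\<dots> = (z \<bullet> uvec t) *\<^sub>R uvec t + (z \<bullet> uvec' t) *\<^sub>R uvec' t"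
    by (simp add: r sd)
  finally have "z = (r *\<^sub>R uvec t + q *\<^sub>R uvec' t) + s *\<^sub>R (d *\<^sub>R uvec' t)"
    by (simp only: frame_decomposition [symmetric])
  then show "z \<in> {(r *\<^sub>R uvec t + q *\<^sub>R uvec' t) + s *\<^sub>R (d *\<^sub>R uvec' t) | s. True}"
    by blast
qed

text \<open>
  Cramer's rule for the two line equations; their determinant is \<open>sin \<alpha>\<close>.
\<close>

lemma support_lines_Int:
  assumes "sin \<alpha> \<noteq> 0"
  shows "{z. z \<bullet> uvec t = p t} \<inter> {z. z \<bullet> uvec (t + \<alpha>) = p (t + \<alpha>)} = {vertex_curve p \<alpha> t}"
proof -
  have eq: "sin \<alpha> *\<^sub>R z = (z \<bullet> uvec (t + \<alpha>)) *\<^sub>R uvec' t - (z \<bullet> uvec t) *\<^sub>R uvec' (t + \<alpha>)" for z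
  proof -
    have "sin \<alpha> = sin (t + \<alpha>) * cos t - cos (t + \<alpha>) * sin t"
      using sin_diff [of "t + \<alpha>" t] by simp
    then show ?thesis
      by (simp only: complex_eq_iff)
        (simp add: uvec_def uvec'_def inner_complex_def algebra_simps)
  qed
  have "z = vertex_curve p \<alpha> t" if "z \<bullet> uvec t = p t" "z \<bullet> uvec (t + \<alpha>) = p (t + \<alpha>)" for z
  proof -
    have "z = (1 / sin \<alpha>) *\<^sub>R (sin \<alpha> *\<^sub>R z)"
      using assms by simp
    also have "\<dots> = vertex_curve p \<alpha> t"
      unfolding eq that vertex_curve_def ..
    finally show ?thesis .
  qed
  moreover have "vertex_curve p \<alpha> t \<bullet> uvec t = p t"
    and "vertex_curve p \<alpha> t \<bullet> uvec (t + \<alpha>) = p (t + \<alpha>)"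
    using assms by (simp_all add: vertex_curve_def inner_diff_left)
  ultimately show ?thesis by blast
qed

lemma affine_hull_eq_support_line:
  assumes "x \<noteq> y" "x \<bullet> uvec t = r" "y \<bullet> uvec t = r"
  shows "affine hull {x, y} = {z. z \<bullet> uvec t = r}"
proof -
  define q where "q = x \<bullet> uvec' t"
  define d where "d = (y - x) \<bullet> uvec' t"
  have x: "x = r *\<^sub>R uvec t + q *\<^sub>R uvec' t"
    using frame_decomposition [of x t] assms by (simp add: q_def)
  have "(y - x) \<bullet> uvec t = 0"
    using assms by (simp add: inner_diff_left)
  then have yx: "y - x = d *\<^sub>R uvec' t"
    using frame_decomposition [of "y - x" t] by (simp only: d_def) simp
  then have "d \<noteq> 0" using \<open>x \<noteq> y\<close> by auto
  have "affine hull {x, y} = {x + s *\<^sub>R (y - x) | s. True}"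
    unfolding affine_hull_2_alt by auto
  also have "\<dots> = {(r *\<^sub>R uvec t + q *\<^sub>R uvec' t) + s *\<^sub>R (d *\<^sub>R uvec' t) | s. True}"
    unfolding yx by (subst x) (rule refl)
  also have "\<dots> = {z. z \<bullet> uvec t = r}"
    by (rule support_line_param) fact
  finally show ?thesis .
qed

section \<open>Regular polygons\<close>

text \<open>
  The vertices are the orbit of \<open>c + w\<close> under the rotation by \<open>\<alpha>\<close> about \<open>c\<close>. A rational
  \<open>\<alpha> / (2 * pi)\<close> makes the orbit finite, and \<open>sin \<alpha> \<noteq> 0\<close> excludes orbits of one or two points.
\<close>

context
  fixes Y :: "real \<Rightarrow> complex" and \<alpha> \<phi> :: real and c w :: complex
  assumes Y: "\<And>j. Y (\<phi> + real j * \<alpha>) = c + w * cis (real j * \<alpha>)"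
    and w: "w \<noteq> 0"
    and sin: "sin \<alpha> \<noteq> 0"
    and rat: "\<alpha> / (2 * pi) \<in> \<rat>"
begin

lemma closes_after_iff: "closes_after Y \<alpha> \<phi> N \<longleftrightarrow> 0 < N \<and> cis (real N * \<alpha>) = 1"
proof -
  have "Y (\<phi> + real (j + N) * \<alpha>) = Y (\<phi> + real j * \<alpha>) \<longleftrightarrow> cis (real N * \<alpha>) = 1" for j
  proof -
    have "cis (real (j + N) * \<alpha>) = cis (real j * \<alpha>) * cis (real N * \<alpha>)"
      by (simp add: cis_mult distrib_right)
    then show ?thesis
      unfolding Y using w by simp
  qed
  then show ?thesis
    by (simp add: closes_after_def)
qed

lemma ex_closes_after: "\<exists>N. closes_after Y \<alpha> \<phi> N"
proof -
  obtain i m :: int where m: "m > 0" and q: "\<alpha> / (2 * pi) = of_int i / of_int m"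
    using rat by (auto elim: Rats_cases')
  from q m have "real (nat m) * \<alpha> = 2 * pi * of_int i"
    by (simp add: field_simps)
  then have "cis (real (nat m) * \<alpha>) = 1"
    by (simp add: cis_multiple_2pi)
  with m have "closes_after Y \<alpha> \<phi> (nat m)"
    unfolding closes_after_iff by simp
  then show ?thesis ..
qed

lemma length_polygon_from_ge_3: "3 \<le> length (polygon_from Y \<alpha> \<phi>)"
  and cis_length_polygon_from: "cis (real (length (polygon_from Y \<alpha> \<phi>)) * \<alpha>) = 1"
proof -
  let ?N = "LEAST N. closes_after Y \<alpha> \<phi> N"
  have "closes_after Y \<alpha> \<phi> ?N"
    using ex_closes_after by (rule LeastI_ex)
  then have N: "0 < ?N" "cis (real ?N * \<alpha>) = 1"
    by (simp_all add: closes_after_iff)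
  then show "cis (real (length (polygon_from Y \<alpha> \<phi>)) * \<alpha>) = 1"
    by (simp add: polygon_from_def)
  have "?N \<noteq> 1"
    using N(2) sin by (auto simp: complex_eq_iff)
  moreover have "?N \<noteq> 2"
    using N(2) sin by (auto simp: complex_eq_iff cos_double_sin)
  ultimately show "3 \<le> length (polygon_from Y \<alpha> \<phi>)"
    using N(1) by (simp add: polygon_from_def)
qed

text \<open>
  The index of a vertex need not be reduced modulo the length, since the orbit is periodic with
  that length. This turns all statements about sides into statements about \<open>cis (real j * \<alpha>)\<close>.
\<close>

lemma vertex_polygon_from: "vertex (polygon_from Y \<alpha> \<phi>) j = Y (\<phi> + real j * \<alpha>)"
proof -
  let ?P = "polygon_from Y \<alpha> \<phi>"
  let ?N = "length ?P"
  have N: "0 < ?N" using length_polygon_from_ge_3 by linarith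
  have "cis (real j * \<alpha>) = cis (real (j mod ?N) * \<alpha>)"
  proof -
    have "real j = real (j div ?N) * real ?N + real (j mod ?N)"
      by (simp flip: of_nat_mult of_nat_add)
    then have "cis (real j * \<alpha>) = cis (real (j mod ?N) * \<alpha>) * cis (real ?N * \<alpha>) ^ (j div ?N)"
      by (simp add: Complex.DeMoivre cis_mult algebra_simps)
    then show ?thesis
      by (simp only: cis_length_polygon_from) simp
  qed
  moreover have "vertex ?P j = Y (\<phi> + real (j mod ?N) * \<alpha>)"
    using N by (simp add: vertex_def polygon_from_def)
  ultimately show ?thesis
    by (simp only: Y)
qed

lemma side_polygon_from: "side (polygon_from Y \<alpha> \<phi>) j = w * (cis \<alpha> - 1) * cis (real j * \<alpha>)"
proof -
  have "cis (real (Suc j) * \<alpha>) = cis \<alpha> * cis (real j * \<alpha>)"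
    by (simp add: cis_mult distrib_right)
  then show ?thesis
    unfolding side_def vertex_polygon_from Y by (simp add: algebra_simps)
qed

lemma side_polygon_from_nonzero: "side (polygon_from Y \<alpha> \<phi>) j \<noteq> 0"
proof -
  have "cis \<alpha> \<noteq> 1"
    using sin by (metis cis.sel(2) one_complex.sel(2))
  then show ?thesis
    using w by (simp add: side_polygon_from)
qed

lemma side_ratio_polygon_from:
  "side (polygon_from Y \<alpha> \<phi>) (j + 1) / side (polygon_from Y \<alpha> \<phi>) j = cis \<alpha>"
proof -
  have "cis (real (j + 1) * \<alpha>) = cis \<alpha> * cis (real j * \<alpha>)"
    by (simp add: cis_mult distrib_right)
  then have "side (polygon_from Y \<alpha> \<phi>) (j + 1) = cis \<alpha> * side (polygon_from Y \<alpha> \<phi>) j"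
    unfolding side_polygon_from by (simp only: ac_simps)
  then show ?thesis
    using side_polygon_from_nonzero by simp
qed

text \<open>
  Three consecutive vertices on a line would make the ratio \<open>cis \<alpha>\<close> of two sides real.
\<close>

lemma polygon_polygon_from: "polygon (polygon_from Y \<alpha> \<phi>)"
proof -
  let ?P = "polygon_from Y \<alpha> \<phi>"
  have "\<not> collinear {vertex ?P j, vertex ?P (j + 1), vertex ?P (j + 2)}" for j
  proof
    assume "collinear {vertex ?P j, vertex ?P (j + 1), vertex ?P (j + 2)}"
    then have "collinear {0, vertex ?P j - vertex ?P (j + 1), vertex ?P (j + 2) - vertex ?P (j + 1)}"
      by (simp add: collinear_3)
    then have "collinear {0, - side ?P j, side ?P (j + 1)}"
      by (simp add: side_def)
    then have "side ?P (j + 1) / (- side ?P j) \<in> \<real>"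
      using side_polygon_from_nonzero by (simp add: collinear_iff_Reals)
    then have "cis \<alpha> \<in> \<real>"
      using side_ratio_polygon_from [of j] by simp
    with sin show False
      by (simp add: complex_is_Real_iff)
  qed
  with length_polygon_from_ge_3 show ?thesis
    by (simp add: polygon_def)
qed

lemma equiangular_polygon_from: "equiangular (polygon_from Y \<alpha> \<phi>) \<alpha>"
proof -
  have "cis (Arg (cis \<alpha>)) = cis \<alpha>"
    by (simp add: cis_Arg sgn_div_norm)
  then have "sin (Arg (cis \<alpha>)) = sin \<alpha> \<and> cos (Arg (cis \<alpha>)) = cos \<alpha>"
    by (simp add: complex_eq_iff)
  then obtain m :: int where "Arg (cis \<alpha>) = \<alpha> + 2 * pi * of_int m"
    by (auto simp: sin_cos_eq_iff)
  then show ?thesis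
    unfolding equiangular_def external_angle_def side_ratio_polygon_from by blast
qed

lemma equilateral_polygon_from:
  "equilateral (polygon_from Y \<alpha> \<phi>) (2 * norm w * \<bar>sin (\<alpha> / 2)\<bar>)"
proof -
  have "cis \<alpha> - 1 = 2 * \<i> * of_real (sin (\<alpha> / 2)) * cis (\<alpha> / 2)"
    using sin_double [of "\<alpha> / 2"] cos_double_sin [of "\<alpha> / 2"]
    by (simp add: complex_eq_iff power2_eq_square)
  then have "norm (cis \<alpha> - 1) = 2 * \<bar>sin (\<alpha> / 2)\<bar>"
    by (simp add: norm_mult)
  then show ?thesis
    by (simp add: equilateral_def side_polygon_from norm_mult)
qed

text \<open>
  A point equidistant from the vertices lies, like \<open>c\<close>, on the perpendicular bisector of every side,
  so \<open>z - c\<close> is orthogonal to all sides. The first two sides already span the plane, because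
  \<open>sin \<alpha> \<noteq> 0\<close>.
\<close>

lemma is_center_polygon_from_iff: "is_center z (polygon_from Y \<alpha> \<phi>) \<longleftrightarrow> z = c"
proof
  let ?P = "polygon_from Y \<alpha> \<phi>"
  have set_P: "set ?P = {Y (\<phi> + real j * \<alpha>) | j. j < length ?P}"
    by (auto simp: polygon_from_def)
  show "is_center z ?P" if "z = c"
    unfolding is_center_def set_P using that
    by (intro exI [of _ "norm w"]) (auto simp: Y dist_norm norm_mult)
  show "z = c" if center: "is_center z ?P"
  proof -
    from center obtain r where r: "\<And>v. v \<in> set ?P \<Longrightarrow> dist z v = r"
      by (auto simp: is_center_def)
    have "dist z (Y (\<phi> + real j * \<alpha>)) = r" if "j < 3" for j
    proof (rule r)
      have "j < length ?P" using that length_polygon_from_ge_3 by linarith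
      then show "Y (\<phi> + real j * \<alpha>) \<in> set ?P" unfolding set_P by blast
    qed
    then have dist_vertex: "dist z (vertex ?P j) = r" if "j < 3" for j
      using that by (simp add: vertex_polygon_from)
    \<comment> \<open>\<open>g\<close> is the first side, and \<open>g * cis \<alpha>\<close> the second.\<close>
    define g where "g = w * (cis \<alpha> - 1)"
    have orth: "(z - c) \<bullet> side ?P j = 0" if "j < 2" for j
    proof -
      have on_circle: "norm (vertex ?P i - c) = norm w" for i
        by (simp add: vertex_polygon_from Y norm_mult)
      have polar: "norm (z - v) ^ 2 = norm (z - c) ^ 2 - 2 * ((z - c) \<bullet> (v - c)) + norm (v - c) ^ 2"
        for v
        by (simp add: power2_norm_eq_inner inner_diff_left inner_diff_right inner_commute)
      have "norm (z - vertex ?P (Suc j)) ^ 2 = norm (z - vertex ?P j) ^ 2"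
        using dist_vertex [of j] dist_vertex [of "Suc j"] that by (simp add: dist_norm)
      then have "(z - c) \<bullet> (vertex ?P (Suc j) - c) = (z - c) \<bullet> (vertex ?P j - c)"
        unfolding polar [of "vertex ?P j"] polar [of "vertex ?P (Suc j)"] on_circle by simp
      then show ?thesis
        by (simp add: side_def inner_diff_right)
    qed
    have "(z - c) \<bullet> g = 0"
      using orth [of 0] by (simp add: side_polygon_from g_def)
    moreover have "(z - c) \<bullet> (g * cis \<alpha>) = 0"
      using orth [of 1] by (simp add: side_polygon_from g_def)
    moreover have "(z - c) \<bullet> (g * cis \<alpha>)
        = cos \<alpha> * ((z - c) \<bullet> g) + sin \<alpha> * ((z - c) \<bullet> (\<i> * g))"
      by (simp add: inner_complex_def algebra_simps)
    ultimately have "(z - c) \<bullet> g = 0" "(z - c) \<bullet> (\<i> * g) = 0"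
      using sin by auto
    moreover have "(z - c) * cnj g = of_real ((z - c) \<bullet> g) + \<i> * of_real ((z - c) \<bullet> (\<i> * g))"
      by (simp add: complex_eq_iff inner_complex_def algebra_simps)
    moreover have "g \<noteq> 0"
      using side_polygon_from_nonzero [of 0] by (simp add: side_polygon_from g_def)
    ultimately show ?thesis
      by simp
  qed
qed

end

section \<open>Vertex curve and epitrochoids\<close>

text \<open>
  After multiplication by \<open>sin \<alpha>\<close>, the curve is \<open>\<i> * cis \<phi>\<close> times
  \<open>p (\<phi> + \<alpha>) - p \<phi> * cis \<alpha>\<close>. The constant part of \<open>p\<close> gives the rotation with frequency one.
  In the cosine part, after the shift \<open>l * \<alpha> \<equiv> - \<alpha>\<close> modulo \<open>2 * pi\<close>, the terms with
  \<open>cis (- l * \<phi>)\<close> cancel and only the frequency \<open>l + 1\<close> survives.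
\<close>

lemma vertex_curve_eq:
  fixes k :: nat
  assumes "l > 0" and \<alpha>: "\<alpha> = 2 * real k * pi / (l + 1)" and "sin \<alpha> \<noteq> 0"
  shows "vertex_curve (\<lambda>t. a + cos (l * t)) \<alpha> \<phi>
    = cis ((l + 1) * \<phi>) + of_real (a / cos (\<alpha> / 2)) * cis (\<phi> + \<alpha> / 2)"
proof -
  have sin2: "sin \<alpha> = 2 * sin (\<alpha> / 2) * cos (\<alpha> / 2)"
    using sin_double [of "\<alpha> / 2"] by simp
  with \<open>sin \<alpha> \<noteq> 0\<close> have half: "sin (\<alpha> / 2) \<noteq> 0" "cos (\<alpha> / 2) \<noteq> 0"
    by auto
  have "l * \<alpha> = 2 * pi * real k - \<alpha>"
    using \<open>l > 0\<close> by (simp add: \<alpha> field_simps)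
  then have "l * (\<phi> + \<alpha>) = (l * \<phi> - \<alpha>) + 2 * pi * real k"
    by (simp add: distrib_left)
  then have cos_shift: "cos (l * (\<phi> + \<alpha>)) = cos (l * \<phi> - \<alpha>)"
    using cos.plus_of_nat [of "l * \<phi> - \<alpha>" k] by (simp add: mult.commute mult.left_commute)
  have half_angle: "\<i> * (1 - cis \<alpha>) = 2 * of_real (sin (\<alpha> / 2)) * cis (\<alpha> / 2)"
    using sin_double [of "\<alpha> / 2"] cos_double_sin [of "\<alpha> / 2"]
    by (simp add: complex_eq_iff power2_eq_square)
  have cos_part: "of_real (cos (l * \<phi> - \<alpha>)) - of_real (cos (l * \<phi>)) * cis \<alpha>
      = - \<i> * of_real (sin \<alpha>) * cis (l * \<phi>)"
    by (simp add: complex_eq_iff cos_diff algebra_simps)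
  have "of_real (sin \<alpha>) * vertex_curve (\<lambda>t. a + cos (l * t)) \<alpha> \<phi>
      = \<i> * cis \<phi> * (of_real a * (1 - cis \<alpha>)
          + (of_real (cos (l * \<phi> - \<alpha>)) - of_real (cos (l * \<phi>)) * cis \<alpha>))"
    unfolding vertex_curve_def cos_shift uvec'_eq_cis scaleR_conv_of_real cis_mult [symmetric]
    using \<open>sin \<alpha> \<noteq> 0\<close> by (simp add: algebra_simps)
  also have "\<dots> = of_real a * cis \<phi> * (\<i> * (1 - cis \<alpha>)) + of_real (sin \<alpha>) * (cis (l * \<phi>) * cis \<phi>)"
    unfolding cos_part by (simp add: algebra_simps)
  also have "\<dots> = of_real (sin \<alpha>) *
      (cis ((l + 1) * \<phi>) + of_real (a / cos (\<alpha> / 2)) * cis (\<phi> + \<alpha> / 2))"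
    unfolding half_angle sin2 using half
    by (simp add: cis_mult algebra_simps)
  finally show ?thesis
    using \<open>sin \<alpha> \<noteq> 0\<close> by simp
qed

text \<open>
  The relative phase \<open>\<beta>\<close> of the two rotations is removed by the parameter shift \<open>s\<close> together with
  the rotation by \<open>\<beta> - s\<close>; the shift must satisfy \<open>\<beta> - s + \<nu> * s = 0\<close>, which is solvable as
  \<open>\<nu> \<noteq> 1\<close>.
\<close>

lemma epitrochoid_sum_of_rotations:
  assumes "A \<noteq> 0" "B \<noteq> 0" "\<nu> > 1"
  shows "epitrochoid (\<lambda>t. of_real B * cis (\<nu> * t) + of_real A * cis (t + \<beta>))"
proof -
  define s where "s = - \<beta> / (\<nu> - 1)"
  have "(\<nu> - 1) * s = - \<beta>"
    using assms by (simp add: s_def)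
  then have s: "\<beta> - s + \<nu> * s = 0"
    by (simp add: algebra_simps)
  have "reparametrization (\<lambda>t. t + s)"
    unfolding reparametrization_def
  proof (intro conjI allI exI)
    show "bij (\<lambda>t. t + s)"
      by (rule bij_betw_byWitness [where f' = "\<lambda>t. t - s"]) auto
    show "(1 :: real) \<noteq> 0" by simp
    show "((\<lambda>t. t + s) has_real_derivative 1) (at t)" for t
      by (auto intro!: derivative_eq_intros)
  qed
  moreover have "euclidean_motion (\<lambda>z. cis (\<beta> - s) * z)"
    by (simp add: euclidean_motion_def dist_norm norm_mult flip: right_diff_distrib)
  moreover have "of_real B * cis (\<nu> * t) + of_real A * cis (t + \<beta>)
      = cis (\<beta> - s) * (A *\<^sub>R uvec (t + s) + B *\<^sub>R uvec (\<nu> * (t + s)))" for t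
  proof -
    have "t + \<beta> = (\<beta> - s) + (t + s)" "\<nu> * t = (\<beta> - s) + \<nu> * (t + s)"
      using s by (simp_all add: algebra_simps)
    then have "cis (t + \<beta>) = cis (\<beta> - s) * cis (t + s)"
      "cis (\<nu> * t) = cis (\<beta> - s) * cis (\<nu> * (t + s))"
      by (simp_all only: cis_mult)
    then show ?thesis
      by (simp add: uvec_eq_cis scaleR_conv_of_real distrib_left mult_ac add_ac)
  qed
  ultimately show ?thesis
    unfolding epitrochoid_def using assms by blast
qed

section \<open>Equilateral and equiangular Poncelet polygons\<close>

theorem theorem9:
  fixes k :: nat and l n a \<alpha> :: real and p :: "real \<Rightarrow> real" and X Y :: "real \<Rightarrow> complex"
  assumes "0 < k"
    and "l \<in> \<rat>" and "0 < l"
    and "\<forall>m::int. m \<noteq> 0 \<longrightarrow> l \<noteq> 2 * real k / of_int m - 1"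
    and "n = l + 1"
    and "\<alpha> = 2 * real k * pi / n"
    and "p = (\<lambda>\<phi>. a + cos (l * \<phi>))"
    and "l > 1 \<longrightarrow> a > l\<^sup>2 - 1"
    and "l < 1 \<longrightarrow> a > 1 - l\<^sup>2"
    and "X = envelope_curve p"
    and "Y = vertex_curve p \<alpha>"
  shows "poncelet_pair Y X
    \<and> (\<forall>\<phi>. tangent_line X \<phi> \<inter> tangent_line X (\<phi> + \<alpha>) = {Y \<phi>}
        \<and> (\<exists>N. closes_after Y \<alpha> \<phi> N)
        \<and> poncelet_polygon (polygon_from Y \<alpha> \<phi>) Y X
        \<and> equiangular (polygon_from Y \<alpha> \<phi>) \<alpha>
        \<and> equilateral (polygon_from Y \<alpha> \<phi>) (2 * a * \<bar>tan (\<alpha> / 2)\<bar>))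
    \<and> epitrochoid Y
    \<and> (\<exists>m. (\<forall>\<phi> c. is_center c (polygon_from Y \<alpha> \<phi>) \<longleftrightarrow> c = m \<phi>)
        \<and> rotates_on_circle m 0 1)"
proof -
  note [simp] = assms(5)
  \<comment> \<open>The value \<open>l = 1\<close> is excluded by the case \<open>m = k\<close>, so one of the bounds on \<open>a\<close> applies.\<close>
  have a: "a > \<bar>l\<^sup>2 - 1\<bar>"
  proof -
    have "l \<noteq> 1"
      using assms(4) \<open>0 < k\<close> by (auto dest: spec [of _ "int k"])
    then consider "l > 1" | "l < 1" by linarith
    then show ?thesis
    proof cases
      case 1
      then have "l\<^sup>2 > 1" by (simp add: one_less_power)
      with 1 assms(8) show ?thesis by simp
    next
      case 2
      with \<open>0 < l\<close> have "l\<^sup>2 < 1" by (simp add: power_less_one_iff)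
      with 2 assms(9) show ?thesis by simp
    qed
  qed
  then have "a > 0" by linarith
  have \<alpha>: "\<alpha> = 2 * real k * pi / (l + 1)" using assms(6) by simp
  have sin: "sin \<alpha> \<noteq> 0"
  proof
    assume "sin \<alpha> = 0"
    then obtain i :: int where "\<alpha> = of_int i * pi"
      by (auto simp: sin_zero_iff_int2)
    then have "2 * real k * pi = of_int i * (l + 1) * pi"
      using \<open>0 < l\<close> by (simp add: \<alpha> field_simps)
    then have "2 * real k = of_int i * (l + 1)"
      by simp
    moreover from this have "i \<noteq> 0" using \<open>0 < k\<close> by auto
    ultimately have "l = 2 * real k / of_int i - 1" by (simp add: field_simps)
    with \<open>i \<noteq> 0\<close> assms(4) show False by blast
  qed
  have cos: "cos (\<alpha> / 2) \<noteq> 0"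
    using sin sin_double [of "\<alpha> / 2"] by auto
  have rat: "\<alpha> / (2 * pi) \<in> \<rat>"
  proof -
    have "\<alpha> / (2 * pi) = real k / (l + 1)" by (simp add: \<alpha>)
    then show ?thesis using \<open>l \<in> \<rat>\<close> by simp
  qed

  define R where "R = a / cos (\<alpha> / 2)"
  have "R \<noteq> 0" using \<open>a > 0\<close> cos by (simp add: R_def)
  have Y_eq: "Y \<phi> = cis (n * \<phi>) + of_real R * cis (\<phi> + \<alpha> / 2)" for \<phi>
    using vertex_curve_eq [OF \<open>0 < l\<close> \<alpha> sin] by (simp add: assms(7,11) R_def)
  define w where "w = (\<lambda>\<phi>. of_real R * cis (\<phi> + \<alpha> / 2))"
  have w: "w \<phi> \<noteq> 0" for \<phi> using \<open>R \<noteq> 0\<close> by (simp add: w_def)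
  have Y_orbit: "Y (\<phi> + real j * \<alpha>) = cis (n * \<phi>) + w \<phi> * cis (real j * \<alpha>)" for \<phi> j
  proof -
    have "n * (\<phi> + real j * \<alpha>) = n * \<phi> + 2 * pi * real (k * j)"
      using \<open>0 < l\<close> by (simp add: \<alpha> field_simps)
    then have "cis (n * (\<phi> + real j * \<alpha>)) = cis (n * \<phi>) * cis (2 * pi * real (k * j))"
      by (simp only: cis_mult)
    also have "cis (2 * pi * real (k * j)) = 1"
      by (rule cis_multiple_2pi) simp
    finally show ?thesis
      unfolding Y_eq w_def by (simp add: cis_mult add_ac mult.assoc)
  qed
  note regular = Y_orbit w sin rat

  define p' where "p' = (\<lambda>t. - l * sin (l * t))"
  define p'' where "p'' = (\<lambda>t. - l\<^sup>2 * cos (l * t))"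
  have p': "(p has_real_derivative p' t) (at t)" for t
    unfolding assms(7) p'_def by (auto intro!: derivative_eq_intros)
  have p'': "(p' has_real_derivative p'' t) (at t)" for t
    unfolding p'_def p''_def by (auto intro!: derivative_eq_intros simp: power2_eq_square)
  have X_deriv: "(X has_vector_derivative (p t + p'' t) *\<^sub>R uvec' t) (at t)" for t
    unfolding assms(10) by (rule envelope_curve_has_vector_derivative [OF p' p''])
  have X_vd: "vector_derivative X (at t) = (p t + p'' t) *\<^sub>R uvec' t" for t
    using X_deriv by (rule vector_derivative_at)
  have curvature: "p t + p'' t \<noteq> 0" for t
  proof -
    have "\<bar>(l\<^sup>2 - 1) * cos (l * t)\<bar> \<le> \<bar>l\<^sup>2 - 1\<bar> * 1"
      unfolding abs_mult by (intro mult_left_mono) auto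
    with a have "\<bar>(l\<^sup>2 - 1) * cos (l * t)\<bar> < a" by simp
    moreover have "p t + p'' t = a - (l\<^sup>2 - 1) * cos (l * t)"
      by (simp add: assms(7) p''_def algebra_simps)
    ultimately show ?thesis by linarith
  qed
  have X_regular: "X differentiable at t" "vector_derivative X (at t) \<noteq> 0" for t
    using X_deriv curvature
    by (auto simp: X_vd uvec'_eq_cis intro: differentiableI_vector)
  have tangent: "tangent_line X t = {z. z \<bullet> uvec t = p t}" for t
    unfolding tangent_line_def X_vd unfolding assms(10) envelope_curve_def
    by (rule support_line_param) (rule curvature)
  have inter: "tangent_line X \<phi> \<inter> tangent_line X (\<phi> + \<alpha>) = {Y \<phi>}" for \<phi>
    unfolding tangent assms(11) by (rule support_lines_Int) (rule sin)
  have on_tangents: "Y \<phi> \<in> tangent_line X \<phi>" "Y \<phi> \<in> tangent_line X (\<phi> + \<alpha>)" for \<phi>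
    using inter [of \<phi>] by blast+

  have poncelet: "poncelet_polygon (polygon_from Y \<alpha> \<phi>) Y X" for \<phi>
  proof -
    let ?P = "polygon_from Y \<alpha> \<phi>"
    have "tangent_to (affine hull {vertex ?P j, vertex ?P (j + 1)}) X" for j
    proof -
      let ?t = "\<phi> + real (j + 1) * \<alpha>"
      have v: "vertex ?P j = Y (\<phi> + real j * \<alpha>)" "vertex ?P (j + 1) = Y ?t"
        by (rule vertex_polygon_from [OF regular])+
      have "\<phi> + real j * \<alpha> + \<alpha> = ?t" by (simp add: algebra_simps)
      then have "vertex ?P j \<in> tangent_line X ?t" "vertex ?P (j + 1) \<in> tangent_line X ?t"
        using on_tangents(2) [of "\<phi> + real j * \<alpha>"] on_tangents(1) [of ?t] by (simp_all only: v)
      moreover have "vertex ?P j \<noteq> vertex ?P (j + 1)"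
        using side_polygon_from_nonzero [OF regular, of \<phi> j] by (auto simp: side_def)
      ultimately have "affine hull {vertex ?P j, vertex ?P (j + 1)} = tangent_line X ?t"
        unfolding tangent by (intro affine_hull_eq_support_line) simp_all
      then show ?thesis
        using X_regular unfolding tangent_to_def by blast
    qed
    then have "circumscribed ?P X" by (simp add: circumscribed_def)
    moreover have "inscribed ?P Y" by (auto simp: inscribed_def polygon_from_def)
    moreover have "polygon ?P" by (rule polygon_polygon_from [OF regular])
    ultimately show ?thesis by (simp add: poncelet_polygon_def)
  qed

  have pair: "poncelet_pair Y X"
  proof -
    obtain i m :: int where m: "m > 0" and lm: "l = of_int i / of_int m"
      using \<open>l \<in> \<rat>\<close> by (auto elim: Rats_cases')
    \<comment> \<open>For \<open>l = i / m\<close> this is a common period of \<open>cis t\<close> and \<open>cis (l * t)\<close>.\<close>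
    define T where "T = 2 * pi * of_int m"
    have "T > 0" using m by (simp add: T_def)
    have lT: "l * T = 2 * pi * of_int i" using m by (simp add: T_def lm)
    have cis_T: "cis (t + T) = cis t" for t
      unfolding cis_mult [symmetric] T_def by (simp add: cis_multiple_2pi)
    have cis_lT: "cis (l * (t + T)) = cis (l * t)" for t
      unfolding distrib_left lT cis_mult [symmetric] by (simp add: cis_multiple_2pi)
    have "cis (n * (t + T)) = cis (n * t)" for t
      using arg_cong2 [OF cis_lT [of t] cis_T [of t], of "(*)"]
      by (simp add: cis_mult algebra_simps)
    moreover have "cis (t + T + \<alpha> / 2) = cis (t + \<alpha> / 2)" for t
      using cis_T [of "t + \<alpha> / 2"] by (simp add: add_ac)
    ultimately have "Y (t + T) = Y t" for t
      by (simp only: Y_eq)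
    moreover have "continuous_on UNIV Y"
      unfolding Y_eq [abs_def] by (intro continuous_intros)
    ultimately have "closed_curve Y"
      unfolding closed_curve_def using \<open>T > 0\<close> by blast
    moreover have "X (t + T) = X t" for t
    proof -
      have "deriv p = p'" using p' by (auto intro!: ext DERIV_imp_deriv)
      moreover have "cos (l * (t + T)) = cos (l * t)" "sin (l * (t + T)) = sin (l * t)"
        using cis_lT [of t] by (simp_all add: complex_eq_iff)
      ultimately show ?thesis
        by (simp only: assms(10) envelope_curve_def uvec_eq_cis uvec'_eq_cis cis_T
            assms(7) p'_def)
    qed
    moreover have "continuous_on UNIV X"
      using X_deriv by (auto intro!: continuous_at_imp_continuous_on
          intro: has_vector_derivative_continuous)
    ultimately have "closed_curve Y" "closed_curve X"
      unfolding closed_curve_def using \<open>T > 0\<close> by blast+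
    moreover have "Y \<phi> \<in> set (polygon_from Y \<alpha> \<phi>)" for \<phi>
    proof -
      have "0 < length (polygon_from Y \<alpha> \<phi>)"
        using length_polygon_from_ge_3 [OF regular, of \<phi>] by linarith
      then have "vertex (polygon_from Y \<alpha> \<phi>) 0 \<in> set (polygon_from Y \<alpha> \<phi>)"
        by (simp add: vertex_def)
      then show ?thesis
        by (simp add: vertex_polygon_from [OF regular])
    qed
    ultimately show ?thesis
      unfolding poncelet_pair_def using poncelet by blast
  qed

  have equilat: "equilateral (polygon_from Y \<alpha> \<phi>) (2 * a * \<bar>tan (\<alpha> / 2)\<bar>)" for \<phi>
  proof -
    have "2 * norm (w \<phi>) * \<bar>sin (\<alpha> / 2)\<bar> = 2 * a * \<bar>tan (\<alpha> / 2)\<bar>"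
      using \<open>a > 0\<close> by (simp add: w_def R_def norm_mult norm_divide tan_def)
    then show ?thesis
      using equilateral_polygon_from [OF regular, of \<phi>] by (simp only:)
  qed

  have "epitrochoid (\<lambda>t. of_real 1 * cis (n * t) + of_real R * cis (t + \<alpha> / 2))"
    by (rule epitrochoid_sum_of_rotations) (use \<open>R \<noteq> 0\<close> \<open>0 < l\<close> in simp_all)
  then have epi: "epitrochoid Y"
    by (simp add: Y_eq [abs_def])

  have center: "is_center c (polygon_from Y \<alpha> \<phi>) \<longleftrightarrow> c = cis (n * \<phi>)" for \<phi> c
    by (rule is_center_polygon_from_iff [OF regular])
  have rotates: "rotates_on_circle (\<lambda>\<phi>. cis (n * \<phi>)) 0 1"
    unfolding rotates_on_circle_def
  proof (intro exI [of _ "\<lambda>t. n * t"] conjI allI)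
    show "continuous_on UNIV (\<lambda>t. n * t)" by (intro continuous_intros)
    have "n \<noteq> 0" using \<open>0 < l\<close> by simp
    then show "bij (\<lambda>t. n * t)"
      by (intro bij_betw_byWitness [where f' = "\<lambda>t. t / n"]) auto
  qed (simp add: uvec_eq_cis)

  have "\<exists>m. (\<forall>\<phi> c. is_center c (polygon_from Y \<alpha> \<phi>) \<longleftrightarrow> c = m \<phi>) \<and> rotates_on_circle m 0 1"
    using center rotates by (intro exI [of _ "\<lambda>\<phi>. cis (n * \<phi>)"] conjI allI)
  with pair epi show ?thesis
    by (intro conjI allI inter ex_closes_after [OF regular] poncelet equilat
        equiangular_polygon_from [OF regular])
qed

end
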